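(* Let $\epsilon>0$. Then the inequality $$\omega(M_n) > 2^{(1-\epsilon)\log\log n} - 3$$ holds for almost all positive integers $n$, i.e., the set of positive integers $n$ for which it fails has natural density $0$.
   Context: For an integer $n\ge 0$, $M_n=2^n-1$ denotes the $n$-th Mersenne number. For a positive integer $m$, $\omega(m)$ denotes the number of distinct prime divisors of $m$. Here $\log$ is the natural logarithm. *)

theory Defs
  imports Complex_Main "HOL-Computational_Algebra.Primes"
begin

definition mersenne :: "nat \<Rightarrow> nat" where
  "mersenne n = 2 ^ n - 1"

definition omega :: "nat \<Rightarrow> nat" where
  "omega m = card (prime_factors m)"

definition has_natural_density :: "nat set \<Rightarrow> real \<Rightarrow> bool" where
  "has_natural_density A d \<longleftrightarrow>
     (\<lambda>N. real (card (A \<inter> {1..N})) / real N) \<longlonglongrightarrow> d"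

definition almost_all :: "(nat \<Rightarrow> bool) \<Rightarrow> bool" where
  "almost_all P \<longleftrightarrow> has_natural_density {n. 0 < n \<and> \<not> P n} 0"

end

theory Submission
  imports Defs "HOL-Computational_Algebra.Squarefree" "HOL-Number_Theory.Pocklington"
    "HOL-Analysis.Harmonic_Numbers"
begin

text \<open>
  If \<open>d > 1\<close> is odd and the reciprocals of its prime factors sum to at most \<open>1/2\<close>, then some prime
  \<open>q\<close> has \<open>ord q 2 = d\<close>: otherwise, by lifting the exponent, \<open>M\<^sub>d\<close> divides the product of \<open>d\<close> and
  all \<open>M\<^bsub>d/r\<^esub>\<close> with \<open>r\<close> a prime factor of \<open>d\<close>, which is at most \<open>d 2\<^bsup>d/2\<^esup>\<close>. This avoids the full
  theorem of Bang and Zsigmondy. Let \<open>w\<close> be the number of prime factors of \<open>n\<close> exceeding \<open>K\<close>. If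
  their reciprocals sum to at most \<open>1/2\<close>, then the nonempty products of these primes give
  \<open>\<omega>(M\<^sub>n) \<ge> 2\<^bsup>w\<^esup> - 1\<close>. By Markov's inequality the condition on the reciprocals fails on a set of
  upper density at most \<open>2/K\<close>, and by Turan's variance argument \<open>w\<close> is rarely below
  \<open>(1 - \<epsilon>/2) S\<close>, where \<open>S\<close> sums \<open>1/p\<close> over the primes \<open>K < p \<le> N\<close>. Only a lower bound for \<open>S\<close> is
  needed; it follows by writing each \<open>m \<le> N\<close> as a squarefree number times a square.
\<close>

section \<open>Turan's variance inequality\<close>

lemma card_multiples_atMost:
  fixes d N :: nat
  assumes "d > 0"
  shows "card {n\<in>{1..N}. d dvd n} = N div d"
proof -
  have "{n\<in>{1..N}. d dvd n} = (*) d ` {1..N div d}"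
  proof (intro equalityI subsetI)
    fix n assume "n \<in> {n\<in>{1..N}. d dvd n}"
    then obtain k where "n = d * k" "1 \<le> n" "n \<le> N" by auto
    thus "n \<in> (*) d ` {1..N div d}"
      using assms by (auto simp: less_eq_div_iff_mult_less_eq mult_ac Suc_le_eq intro!: imageI)
  qed (use assms in \<open>auto simp: less_eq_div_iff_mult_less_eq mult_ac Suc_le_eq\<close>)
  thus ?thesis using assms by (simp add: card_image inj_on_def)
qed

lemma sum_of_bool_dvd:
  assumes "d > 0"
  shows "(\<Sum>n=1..N. of_bool (d dvd n)) = real (N div d)"
  using card_multiples_atMost[OF assms, of N] by (simp add: sum.If_cases Int_def of_bool_def)

text \<open>When the square is expanded, the mean is multiplied by \<open>- 2 * S\<close>, so it
  needs only a lower bound, and the second moment only an upper bound. Rounding in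
  \<open>N div p\<close> costs at most 1 per prime in the mean, whence the term
  \<open>2 * real (card P)\<close>.\<close>

lemma Turan_variance_le:
  fixes P :: "nat set"
  assumes fin: "finite P" and prime: "\<And>p. p \<in> P \<Longrightarrow> prime p"
  defines "S \<equiv> \<Sum>p\<in>P. 1 / real p"
  shows "(\<Sum>n=1..N. (real (card {p\<in>P. p dvd n}) - S)\<^sup>2) \<le> S * (real N + 2 * real (card P))"
proof -
  define w where "w = (\<lambda>n. real (card {p\<in>P. p dvd n}))"
  have w: "w n = (\<Sum>p\<in>P. of_bool (p dvd n))" for n
    using fin by (simp add: w_def of_bool_def sum.If_cases Int_def)
  have pos: "p > 0" if "p \<in> P" for p using prime[OF that] prime_gt_0_nat by blast
  have S0: "S \<ge> 0" by (simp add: S_def sum_nonneg)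
  have "real N * S - real (card P) = (\<Sum>p\<in>P. real N / real p - 1)"
    by (simp add: S_def sum_subtractf sum_distrib_left)
  also have "\<dots> \<le> (\<Sum>p\<in>P. real (N div p))"
  proof (intro sum_mono)
    fix p
    show "real N / real p - 1 \<le> real (N div p)"
      using real_of_int_div3[of "int N" "int p"] by (simp flip: zdiv_int)
  qed
  also have "\<dots> = (\<Sum>p\<in>P. \<Sum>n=1..N. of_bool (p dvd n))"
    using pos by (intro sum.cong refl) (simp only: sum_of_bool_dvd)
  also have "\<dots> = (\<Sum>n=1..N. w n)" unfolding w by (rule sum.swap)
  finally have mean: "real N * S - real (card P) \<le> (\<Sum>n=1..N. w n)" .
  \<comment> \<open>Keeping the product term on the diagonal as well is wasteful, but it lets the
    double sum factor as \<open>S\<^sup>2\<close>.\<close>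
  have pair: "(\<Sum>n=1..N. of_bool (p dvd n) * of_bool (q dvd n))
      \<le> real N * (1 / real p * (1 / real q)) + (if p = q then real N * (1 / real p) else 0)"
    if "p \<in> P" "q \<in> P" for p q
  proof (cases "p = q")
    case True
    have "(\<Sum>n=1..N. of_bool (p dvd n) * of_bool (q dvd n)) = real (N div p)"
      using True sum_of_bool_dvd[OF pos[OF that(1)], of N] by (simp flip: of_bool_conj)
    also have "\<dots> \<le> real N / real p" by (rule of_nat_div_le_of_nat)
    finally show ?thesis using True by (simp add: add_increasing)
  next
    case False
    hence "coprime p q" using that prime by (simp add: primes_coprime)
    hence "p dvd n \<and> q dvd n \<longleftrightarrow> p * q dvd n" for n by (auto intro: divides_mult dest: dvd_mult_left dvd_mult_right)
    hence "(\<Sum>n=1..N. of_bool (p dvd n) * of_bool (q dvd n)) = real (N div (p * q))"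
      using sum_of_bool_dvd[of "p * q" N] pos that by (simp flip: of_bool_conj)
    also have "\<dots> \<le> real N / real (p * q)" by (rule of_nat_div_le_of_nat)
    finally show ?thesis using False by simp
  qed
  have "(\<Sum>n=1..N. (w n)\<^sup>2) = (\<Sum>n=1..N. \<Sum>p\<in>P. \<Sum>q\<in>P. of_bool (p dvd n) * of_bool (q dvd n))"
    by (simp add: w power2_eq_square sum_product)
  also have "\<dots> = (\<Sum>p\<in>P. \<Sum>q\<in>P. \<Sum>n=1..N. of_bool (p dvd n) * of_bool (q dvd n))"
    by (subst sum.swap) (intro sum.cong refl sum.swap)
  also have "\<dots> \<le> (\<Sum>p\<in>P. \<Sum>q\<in>P. real N * (1 / real p * (1 / real q)) + (if p = q then real N * (1 / real p) else 0))"
    by (intro sum_mono pair)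
  also have "\<dots> = real N * S\<^sup>2 + real N * S"
  proof -
    have "(\<Sum>p\<in>P. \<Sum>q\<in>P. real N * (1 / real p * (1 / real q))) = real N * S\<^sup>2"
      by (simp only: S_def power2_eq_square sum_product flip: sum_distrib_left)
    moreover have "(\<Sum>p\<in>P. \<Sum>q\<in>P. if p = q then real N * (1 / real p) else 0) = real N * S"
      using fin by (simp add: S_def sum_distrib_left)
    ultimately show ?thesis by (simp only: sum.distrib)
  qed
  finally have second: "(\<Sum>n=1..N. (w n)\<^sup>2) \<le> real N * S\<^sup>2 + real N * S" .
  have "(\<Sum>n=1..N. (w n - S)\<^sup>2) = (\<Sum>n=1..N. (w n)\<^sup>2) - 2 * S * (\<Sum>n=1..N. w n) + real N * S\<^sup>2"
    by (simp add: power2_diff sum.distrib sum_subtractf sum_distrib_left mult_ac)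
  also have "\<dots> \<le> (real N * S\<^sup>2 + real N * S) - 2 * S * (real N * S - real (card P)) + real N * S\<^sup>2"
    using second mean S0 by (intro add_mono diff_mono mult_left_mono) auto
  also have "\<dots> = S * (real N + 2 * real (card P))" by (simp add: algebra_simps power2_eq_square)
  finally show ?thesis by (simp add: w_def)
qed

lemma Markov_card:
  fixes f :: "nat \<Rightarrow> real"
  assumes "finite A" "\<And>x. x \<in> A \<Longrightarrow> f x \<ge> 0" "t > 0"
  shows "real (card {x\<in>A. f x \<ge> t}) \<le> (\<Sum>x\<in>A. f x) / t"
proof -
  have "real (card {x\<in>A. f x \<ge> t}) * t = (\<Sum>x\<in>{x\<in>A. f x \<ge> t}. t)" by simp
  also have "\<dots> \<le> (\<Sum>x\<in>{x\<in>A. f x \<ge> t}. f x)" by (intro sum_mono) auto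
  also have "\<dots> \<le> (\<Sum>x\<in>A. f x)" using assms by (intro sum_mono2) auto
  finally show ?thesis using assms by (simp add: pos_le_divide_eq)
qed

text \<open>Chebyshev's inequality for the lower tail: a shortfall of at least \<open>t\<close>
  makes the squared deviation at least \<open>t\<^sup>2\<close>, so Markov's inequality applies to
  the variance bound.\<close>

lemma card_few_prime_divisors_le:
  fixes P :: "nat set"
  assumes "finite P" "\<And>p. p \<in> P \<Longrightarrow> prime p" and t: "t > 0"
  defines "S \<equiv> \<Sum>p\<in>P. 1 / real p"
  shows "real (card {n\<in>{1..N}. real (card {p\<in>P. p dvd n}) \<le> S - t})
    \<le> S * (real N + 2 * real (card P)) / t\<^sup>2"
proof -
  let ?w = "\<lambda>n. real (card {p\<in>P. p dvd n})"
  have "t\<^sup>2 \<le> (?w n - S)\<^sup>2" if "?w n \<le> S - t" for n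
    using that t power_mono[of t "S - ?w n" 2] by (simp add: power2_commute)
  hence "card {n\<in>{1..N}. ?w n \<le> S - t} \<le> card {n\<in>{1..N}. (?w n - S)\<^sup>2 \<ge> t\<^sup>2}"
    by (intro card_mono) auto
  also have "real \<dots> \<le> (\<Sum>n=1..N. (?w n - S)\<^sup>2) / t\<^sup>2"
    using t by (intro Markov_card) auto
  also have "\<dots> \<le> S * (real N + 2 * real (card P)) / t\<^sup>2"
    unfolding S_def using assms(1,2) by (intro divide_right_mono Turan_variance_le) auto
  finally show ?thesis by simp
qed

section \<open>Integers whose prime divisors have a large reciprocal sum\<close>

lemma sum_inverse_squares_tail_le:
  assumes "K > 0"
  shows "(\<Sum>k\<in>{K<..N}. 1 / (real k)\<^sup>2) \<le> 1 / real K"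
proof (cases "K \<le> N")
  case True
  have "(\<Sum>k\<in>{K<..N}. 1 / (real k)\<^sup>2) \<le> 1 / real K - 1 / real N"
    using True
  proof (induction N rule: dec_induct)
    case (step N)
    \<comment> \<open>Telescoping: the right-hand side is 1/(N(N+1)).\<close>
    have "1 / (real N + 1)\<^sup>2 \<le> 1 / real N - 1 / (real N + 1)"
      using assms step by (simp add: divide_simps power2_eq_square)
    moreover have "{K<..Suc N} = insert (Suc N) {K<..N}" using step by auto
    ultimately show ?case using step by (simp add: add.commute)
  qed simp
  also have "\<dots> \<le> 1 / real K" by simp
  finally show ?thesis .
qed simp

text \<open>Summed over \<open>n\<close>, each \<open>p\<close> contributes at most N/p^2, and the
  squares beyond \<open>K\<close> add up to at most N/K. Markov's inequality with threshold 1/2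
  doubles this.\<close>

lemma card_large_reciprocal_sum_le:
  assumes K: "K > 0" and P: "P \<subseteq> {K<..M}"
  shows "real (card {n\<in>{1..N}. (\<Sum>p | p \<in> P \<and> p dvd n. 1 / real p) \<ge> 1 / 2}) \<le> 2 * real N / real K"
proof -
  have fin: "finite P" using P finite_subset by blast
  let ?f = "\<lambda>n. \<Sum>p | p \<in> P \<and> p dvd n. 1 / real p"
  have "(\<Sum>n=1..N. ?f n) = (\<Sum>n=1..N. \<Sum>p\<in>P. of_bool (p dvd n) * (1 / real p))"
    using fin by (intro sum.cong refl sum.mono_neutral_cong_left) auto
  also have "\<dots> = (\<Sum>p\<in>P. \<Sum>n=1..N. of_bool (p dvd n) * (1 / real p))" by (rule sum.swap)
  also have "\<dots> = (\<Sum>p\<in>P. real (N div p) * (1 / real p))"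
    using P K by (intro sum.cong refl) (subst sum_distrib_right[symmetric], subst sum_of_bool_dvd, auto)
  also have "\<dots> \<le> (\<Sum>p\<in>P. real N / real p * (1 / real p))"
    by (intro sum_mono mult_right_mono of_nat_div_le_of_nat) auto
  also have "\<dots> = real N * (\<Sum>p\<in>P. 1 / (real p)\<^sup>2)"
    by (simp add: sum_distrib_left power2_eq_square)
  also have "\<dots> \<le> real N * (\<Sum>k\<in>{K<..M}. 1 / (real k)\<^sup>2)"
    using P by (intro mult_left_mono sum_mono2) auto
  also have "\<dots> \<le> real N * (1 / real K)"
    using sum_inverse_squares_tail_le[OF K] by (intro mult_left_mono) auto
  finally have "(\<Sum>n=1..N. ?f n) / (1 / 2) \<le> 2 * real N / real K" by simp
  moreover have "real (card {n\<in>{1..N}. ?f n \<ge> 1 / 2}) \<le> (\<Sum>n=1..N. ?f n) / (1 / 2)"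
    by (intro Markov_card) (auto intro: sum_nonneg)
  ultimately show ?thesis by (rule order_trans[rotated])
qed

section \<open>Lower bound for the sum of prime reciprocals\<close>

lemma prod_prime_factors_squarefree:
  fixes n :: nat
  assumes "squarefree n"
  shows "\<Prod>(prime_factors n) = n"
proof -
  have n: "n > 0" using assms by (intro gr0I) auto
  have "(\<Prod>p\<in>prime_factors n. p ^ multiplicity p n) = \<Prod>(prime_factors n)"
  proof (intro prod.cong refl)
    fix p assume p: "p \<in> prime_factors n"
    have "multiplicity p n \<le> 1"
      using p assms n squarefree_factorial_semiring''[of n] by auto
    moreover have "multiplicity p n > 0" using p by (simp add: prime_factors_multiplicity)
    ultimately have "multiplicity p n = 1" by simp
    thus "p ^ multiplicity p n = p" by simp
  qed
  thus ?thesis using prime_factorization_nat[OF n] by simp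
qed

text \<open>Writing m = s a^2 with s squarefree maps \<open>{1..n}\<close> injectively to pairs of a
  number a and a set of primes up to \<open>n\<close>. Summing 1/m over all such pairs gives a
  product: the sum of 1/a^2 is at most 2, and the other factor is the product of 1 + 1/p, bounded by
  the exponential.\<close>

lemma harm_le_exp_sum_primes:
  "harm n \<le> 2 * exp (\<Sum>p | prime p \<and> p \<le> n. 1 / real p)"
proof -
  define P where "P = {p::nat. prime p \<and> p \<le> n}"
  define f where "f = (\<lambda>m::nat. (square_part m, prime_factors (squarefree_part m)))"
  define g where "g = (\<lambda>(a, T). 1 / (real a)\<^sup>2 * (\<Prod>p\<in>T. 1 / real p))"
  have finP: "finite P" by (rule finite_subset[of _ "{..n}"]) (auto simp: P_def)
  have m_eq: "m = \<Prod>(prime_factors (squarefree_part m)) * (square_part m)\<^sup>2" for m :: nat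
    using squarefree_decompose[of m] by (simp add: prod_prime_factors_squarefree)
  have inj: "inj_on f {1..n}"
    by (rule inj_onI) (metis f_def m_eq prod.inject)
  have g_eq: "1 / real m = g (f m)" for m
  proof -
    have "real m = (\<Prod>p\<in>prime_factors (squarefree_part m). real p) * (real (square_part m))\<^sup>2"
      by (subst m_eq) simp
    thus ?thesis by (simp add: g_def f_def prod_dividef)
  qed
  have sub: "f ` {1..n} \<subseteq> {1..n} \<times> Pow P"
  proof
    fix x assume "x \<in> f ` {1..n}"
    then obtain m where m: "m \<in> {1..n}" "x = f m" by blast
    have "(square_part m)\<^sup>2 dvd m" by blast
    hence "square_part m dvd m" by (metis dvd_mult_left power2_eq_square)
    hence 1: "square_part m \<le> m" using m by (intro dvd_imp_le) auto
    have 0: "square_part m > 0" using m by (intro gr0I) simp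
    have "squarefree_part m dvd m" by (metis dvd_triv_left squarefree_decompose)
    hence "p \<in> P" if "p \<in> prime_factors (squarefree_part m)" for p
      using that m dvd_imp_le[of p m] dvd_trans[of p "squarefree_part m" m] by (auto simp: P_def)
    thus "x \<in> {1..n} \<times> Pow P" using 0 1 m by (auto simp: f_def Suc_le_eq)
  qed
  have "harm n = (\<Sum>m\<in>{1..n}. g (f m))"
    unfolding harm_def by (intro sum.cong refl) (simp add: g_eq[symmetric] field_simps)
  also have "\<dots> = (\<Sum>x\<in>f ` {1..n}. g x)" by (subst sum.reindex[OF inj]) simp
  also have "\<dots> \<le> (\<Sum>x\<in>{1..n} \<times> Pow P. g x)"
    using sub finP by (intro sum_mono2) (auto simp: g_def intro!: prod_nonneg divide_nonneg_nonneg)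
  also have "\<dots> = (\<Sum>a=1..n. 1 / (real a)\<^sup>2) * (\<Sum>T\<in>Pow P. \<Prod>p\<in>T. 1 / real p)"
    by (simp only: sum_product sum.cartesian_product g_def)
  also have "(\<Sum>T\<in>Pow P. \<Prod>p\<in>T. 1 / real p) = (\<Prod>p\<in>P. 1 / real p + 1)"
    using finP by (simp add: prod_add)
  also have "(\<Sum>a=1..n. 1 / (real a)\<^sup>2) * (\<Prod>p\<in>P. 1 / real p + 1) \<le> 2 * (\<Prod>p\<in>P. exp (1 / real p))"
  proof (intro mult_mono prod_mono)
    show "(\<Sum>a=1..n. 1 / (real a)\<^sup>2) \<le> 2"
    proof (cases "n = 0")
      case False
      hence "{1..n} = insert 1 {1<..n}" by auto
      thus ?thesis using sum_inverse_squares_tail_le[of 1 n] by simp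
    qed simp
  qed (auto intro!: prod_nonneg exp_ge_add_one_self_aux add_nonneg_nonneg simp: add.commute)
  also have "(\<Prod>p\<in>P. exp (1 / real p)) = exp (\<Sum>p\<in>P. 1 / real p)"
    using finP by (simp add: exp_sum)
  finally show ?thesis by (simp add: P_def)
qed

text \<open>Take logarithms in the harmonic bound. The factor 2 costs ln 2 < 1, and discarding the
  primes up to \<open>K\<close> costs at most \<open>K\<close>, since each reciprocal is at most
  1.\<close>

lemma sum_primes_between_ge:
  assumes "N \<ge> 2"
  shows "(\<Sum>p | prime p \<and> K < p \<and> p \<le> N. 1 / real p) \<ge> ln (ln (real N)) - (real K + 1)"
proof -
  let ?S = "\<lambda>A. \<Sum>p\<in>A. 1 / real p"
  define A where "A = {p::nat. prime p \<and> p \<le> N}"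
  define B where "B = {p::nat. prime p \<and> K < p \<and> p \<le> N}"
  have fin: "finite A" "finite B" by (auto simp: A_def B_def)
  have "ln (real N) \<le> ln (real N + 1)" using assms by simp
  also have "\<dots> \<le> harm N" by (rule ln_le_harm)
  also have "\<dots> \<le> 2 * exp (?S A)" unfolding A_def by (rule harm_le_exp_sum_primes)
  finally have "ln (ln (real N)) \<le> ln (2 * exp (?S A))" using assms by (subst ln_le_cancel_iff) auto
  also have "\<dots> = ln 2 + ?S A" by (simp add: ln_mult)
  also have "ln 2 \<le> (1::real)" using ln_2_less_1 by simp
  also have "?S A \<le> ?S ({1..K} \<union> B)"
    using fin prime_ge_1_nat by (intro sum_mono2) (auto simp: A_def B_def)
  also have "\<dots> \<le> ?S {1..K} + ?S B" using fin by (subst sum.union_disjoint) (auto simp: B_def)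
  also have "?S {1..K} \<le> real (card {1..K}) * 1" by (rule sum_bounded_above) simp
  finally show ?thesis by (simp add: B_def)
qed

section \<open>Lifting the exponent for geometric sums\<close>

lemma geometric_sum_Suc:
  fixes y :: nat
  shows "Suc y ^ r = 1 + y * (\<Sum>i<r. Suc y ^ i)"
  by (induction r) (auto simp: algebra_simps)

lemma Suc_power_cong_square:
  fixes q k :: nat
  shows "[Suc (q * k) ^ i = 1 + i * (q * k)] (mod q\<^sup>2)"
proof (induction i)
  case (Suc i)
  have "[Suc (q * k) * Suc (q * k) ^ i = Suc (q * k) * (1 + i * (q * k))] (mod q\<^sup>2)"
    using Suc.IH by (intro cong_mult cong_refl)
  also have "Suc (q * k) * (1 + i * (q * k)) = 1 + Suc i * (q * k) + q\<^sup>2 * (i * k\<^sup>2)"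
    by (simp add: algebra_simps power2_eq_square)
  also have "[1 + Suc i * (q * k) + q\<^sup>2 * (i * k\<^sup>2) = 1 + Suc i * (q * k)] (mod q\<^sup>2)"
    unfolding Cong.cong_def by (rule mod_mult_self2)
  finally show ?case by simp
qed (simp add: Cong.cong_def)

text \<open>With y = qk the sum is r + qk r(r-1)/2 modulo q^2. If q and r differ, this is r modulo
  q, hence not divisible by q. If q = r, it is r modulo q^2, so q divides the sum at most
  once.\<close>

lemma multiplicity_geometric_sum_le:
  fixes q r y :: nat
  assumes q: "prime q" and r: "prime r" "odd r" and dvd: "q dvd y"
  shows "multiplicity q (\<Sum>i<r. Suc y ^ i) \<le> multiplicity q r"
proof -
  obtain k where y: "y = q * k" using dvd by blast
  define G where "G = (\<Sum>i<r. Suc y ^ i)"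
  have Gsq: "[G = (\<Sum>i<r. 1 + i * (q * k))] (mod q\<^sup>2)"
    unfolding G_def y by (intro cong_sum Suc_power_cong_square)
  have sum: "(\<Sum>i<r. 1 + i * (q * k)) = r + q * (k * (\<Sum>i<r. i))"
    by (subst sum.distrib) (simp add: sum_distrib_left sum_distrib_right mult_ac)
  show ?thesis
  proof (cases "q = r")
    case False
    have "[G = r + q * (k * (\<Sum>i<r. i))] (mod q)"
      using Gsq sum by (metis cong_modulus_mult_nat power2_eq_square)
    hence "[G = r] (mod q)" by (simp add: Cong.cong_def)
    moreover have "\<not> q dvd r" using False q r primes_dvd_imp_eq by blast
    ultimately have "\<not> q dvd G" using cong_dvd_iff by blast
    thus ?thesis by (simp add: G_def not_dvd_imp_multiplicity_0)
  next
    case True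
    \<comment> \<open>Here oddness matters: r(r-1)/2 = rh is a multiple of r, which fails for r =
      2.\<close>
    obtain h where h: "r = 2 * h + 1" using r(2) by (elim oddE)
    have "(\<Sum>i<2*h+1. i) = (2*h+1) * h" by (induction h) auto
    hence "(\<Sum>i<r. i) = q * h" using True h by simp
    hence "r + q * (k * (\<Sum>i<r. i)) = r + q\<^sup>2 * (k * h)"
      by (simp only: power2_eq_square mult_ac)
    hence "[G = r + q\<^sup>2 * (k * h)] (mod q\<^sup>2)" using Gsq sum by (simp only:)
    hence "[G = r] (mod q\<^sup>2)" by (simp add: Cong.cong_def)
    moreover have "\<not> q\<^sup>2 dvd r"
    proof
      assume "q\<^sup>2 dvd r"
      hence "q\<^sup>2 \<le> q" using True r prime_gt_0_nat by (auto dest: dvd_imp_le)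
      thus False using prime_gt_1_nat[OF q] by (simp add: power2_eq_square)
    qed
    ultimately have "\<not> q\<^sup>2 dvd G" using cong_dvd_iff by blast
    hence "multiplicity q G < 2"
      using q prime_gt_1_nat[OF q] by (intro multiplicity_lessI) (auto intro: gr0I)
    moreover have "multiplicity q r = 1" using True q by simp
    ultimately show ?thesis by (simp add: G_def)
  qed
qed

section \<open>Primitive prime divisors of Mersenne numbers\<close>

lemma mersenne_pos: "n > 0 \<Longrightarrow> mersenne n > 0"
  using one_less_power[of "2 :: nat" n] by (simp add: mersenne_def)

lemma mersenne_div_pos: "n > 0 \<Longrightarrow> r dvd n \<Longrightarrow> mersenne (n div r) > 0"
  by (metis dvd_div_eq_0_iff mersenne_pos neq0_conv)

text \<open>The case q = 2 is covered too: there \<open>ord\<close> takes the value 0, which divides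
  only 0.\<close>

lemma prime_dvd_mersenne_iff:
  assumes "prime q"
  shows "q dvd mersenne n \<longleftrightarrow> ord q (2::nat) dvd n"
proof -
  have "q dvd mersenne n \<longleftrightarrow> [2 ^ n = 1] (mod q)"
    unfolding mersenne_def by (subst cong_altdef_nat) auto
  thus ?thesis by (simp only: ord_divides)
qed

lemma multiplicity_mersenne_mult_le:
  assumes q: "prime q" and r: "prime r" "odd r" and m: "m > 0" and dvd: "q dvd mersenne m"
  shows "multiplicity q (mersenne (m * r)) \<le> multiplicity q (mersenne m) + multiplicity q r"
proof -
  define G where "G = (\<Sum>i<r. Suc (mersenne m) ^ i)"
  have "Suc (mersenne m) = 2 ^ m" by (simp add: mersenne_def)
  hence eq: "mersenne (m * r) = mersenne m * G"
    using geometric_sum_Suc[of "mersenne m" r] 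
    by (simp add: mersenne_def[of "m*r"] power_mult G_def)
  have "G > 0" using mersenne_pos[of "m * r"] m r(1) prime_gt_0_nat[of r] eq
    by (intro gr0I) simp
  hence "multiplicity q (mersenne (m * r)) = multiplicity q (mersenne m) + multiplicity q G"
    using q mersenne_pos[OF m] by (simp add: eq prime_elem_multiplicity_mult_distrib)
  thus ?thesis
    using multiplicity_geometric_sum_le[OF q r dvd] by (simp add: G_def)
qed

text \<open>Compare multiplicities at each prime q dividing \<open>mersenne d\<close>. The order of
  2 modulo q is a proper divisor of d, so some prime r divides the cofactor and q already divides
  \<open>mersenne (d div r)\<close>. Passing from d/r to d adds at most the multiplicity of q in r,
  which the factor d absorbs.\<close>

lemma mersenne_dvd_of_no_primitive_prime:
  assumes d: "odd d" and no: "\<And>q. prime q \<Longrightarrow> ord q (2::nat) \<noteq> d"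
  shows "mersenne d dvd d * (\<Prod>r\<in>prime_factors d. mersenne (d div r))"
proof (rule multiplicity_le_imp_dvd)
  have d0: "d > 0" using d by (intro gr0I) auto
  show "mersenne d \<noteq> 0" using mersenne_pos[OF d0] by simp
  let ?P = "\<Prod>r\<in>prime_factors d. mersenne (d div r)"
  have pos: "mersenne (d div r) > 0" if "r \<in> prime_factors d" for r
    using that d0 by (auto intro: mersenne_div_pos)
  have P0: "?P > 0" using pos by (simp add: prod_pos)
  fix q :: nat assume q: "prime q"
  show "multiplicity q (mersenne d) \<le> multiplicity q (d * ?P)"
  proof (cases "q dvd mersenne d")
    case True
    define e where "e = ord q (2::nat)"
    have "e dvd d" using True q by (simp add: e_def prime_dvd_mersenne_iff)
    then obtain f where f: "d = e * f" by blast
    have "f \<noteq> 1" using no[OF q] f by (auto simp: e_def)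
    then obtain r where r: "prime r" "r dvd f" using prime_factor_nat by blast
    have rd: "r dvd d" using r f by simp
    hence rodd: "odd r" using d by (auto elim: dvdE)
    have rin: "r \<in> prime_factors d" using rd r d0 by (simp add: prime_factors_dvd)
    define m where "m = d div r"
    have m: "d = m * r" using rd by (simp add: m_def)
    have m0: "m > 0" using d0 m by (intro gr0I) simp
    have "e dvd m" using f r by (auto simp: m_def elim!: dvdE)
    hence "q dvd mersenne m" using q by (simp add: e_def prime_dvd_mersenne_iff)
    hence "multiplicity q (mersenne d) \<le> multiplicity q (mersenne m) + multiplicity q r"
      using multiplicity_mersenne_mult_le[OF q r(1) rodd m0] by (simp add: m)
    also have "multiplicity q r \<le> multiplicity q d"
      using rd d0 by (intro dvd_imp_multiplicity_le) auto
    also have "multiplicity q (mersenne m) \<le> multiplicity q ?P"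
      using P0 rin by (intro dvd_imp_multiplicity_le dvd_prodI) (auto simp: m_def)
    finally show ?thesis
      using q P0 d0 by (simp add: prime_elem_multiplicity_mult_distrib)
  qed (simp add: not_dvd_imp_multiplicity_0)
qed

lemma exists_primitive_prime:
  assumes d: "odd d" "d > 1" and small: "(\<Sum>r\<in>prime_factors d. 1 / real r) \<le> 1 / 2"
  shows "\<exists>q. prime q \<and> ord q (2::nat) = d"
proof (rule ccontr)
  assume "\<not> (\<exists>q. prime q \<and> ord q (2::nat) = d)"
  hence dvd: "mersenne d dvd d * (\<Prod>r\<in>prime_factors d. mersenne (d div r))"
    using d(1) by (intro mersenne_dvd_of_no_primitive_prime) auto
  define s where "s = (\<Sum>r\<in>prime_factors d. d div r)"
  obtain h where h: "d = 2 * h + 1" using d(1) by (elim oddE)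
  have "real s = (\<Sum>r\<in>prime_factors d. real d * (1 / real r))"
    unfolding s_def of_nat_sum
    by (intro sum.cong refl) (auto simp: real_of_nat_div prime_factors_dvd)
  also have "\<dots> = real d * (\<Sum>r\<in>prime_factors d. 1 / real r)"
    by (simp add: sum_distrib_left)
  also have "\<dots> \<le> real d * (1 / 2)" using small by (intro mult_left_mono) auto
  \<comment> \<open>The bound is h + 1/2, and \<open>s\<close> is an integer.\<close>
  finally have sh: "s \<le> h" using h by linarith
  have "(\<Prod>r\<in>prime_factors d. mersenne (d div r)) \<le> (\<Prod>r\<in>prime_factors d. 2 ^ (d div r))"
    by (intro prod_mono) (auto simp: mersenne_def)
  also have "\<dots> = 2 ^ s" by (simp add: s_def power_sum)
  also have "\<dots> \<le> 2 ^ h" using sh by simp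
  finally have le: "(\<Prod>r\<in>prime_factors d. mersenne (d div r)) \<le> 2 ^ h" .
  have "0 < (\<Prod>r\<in>prime_factors d. mersenne (d div r))"
    using d by (intro prod_pos) (auto intro: mersenne_div_pos)
  hence "mersenne d \<le> d * (\<Prod>r\<in>prime_factors d. mersenne (d div r))"
    using dvd d(2) by (intro dvd_imp_le) auto
  also have "\<dots> \<le> d * 2 ^ h" using le by simp
  finally have 1: "2 * (2 ^ h * 2 ^ h) \<le> (2 * h + 1) * 2 ^ h + (1::nat)"
    by (simp add: mersenne_def h mult_2 power_add)
  \<comment> \<open>The left side of \<open>1\<close> is at least (2h+2) 2^h = (2h+1) 2^h + 2^h, and
    2^h > 1 because d > 1.\<close>
  have "h + 1 \<le> 2 ^ h" using less_exp[of h] by (simp del: less_exp)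
  hence "2 * ((h + 1) * 2 ^ h) \<le> 2 * (2 ^ h * (2 ^ h :: nat))"
    by (intro mult_le_mono order_refl)
  moreover have "(2 ^ h :: nat) > 1" using h d(2) by (intro one_less_power) auto
  ultimately show False using 1 by (simp add: algebra_simps)
qed

section \<open>Many prime divisors from products of primes dividing n\<close>

lemma prime_factors_prod_primes:
  fixes T :: "nat set"
  assumes "finite T" "\<And>p. p \<in> T \<Longrightarrow> prime p"
  shows "prime_factors (\<Prod>T) = T"
proof -
  have "0 \<notin> T" using assms(2) not_prime_0 by blast
  hence "prime_factors (\<Prod>T) = (\<Union>p\<in>T. prime_factors p)"
    using prime_factors_prod[OF assms(1), of "\<lambda>x. x"] by auto
  also have "\<dots> = T" using assms(2) by (auto simp: prime_prime_factors)
  finally show ?thesis .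
qed

text \<open>Every nonempty subset of \<open>Q\<close> inherits the reciprocal bound, so its product
  is the order of 2 modulo some prime. That order divides n, so the prime divides
  \<open>mersenne n\<close>.\<close>

lemma omega_mersenne_ge:
  assumes n: "n > 0" and Q: "Q \<subseteq> prime_factors n" "2 \<notin> Q"
    and small: "(\<Sum>r\<in>Q. 1 / real r) \<le> 1 / 2"
  shows "2 ^ card Q - 1 \<le> omega (mersenne n)"
proof -
  have finQ: "finite Q" using Q finite_subset by blast
  have prQ: "prime p" if "p \<in> Q" for p using that Q by auto
  let ?S = "Pow Q - {{}}"
  have pf: "prime_factors (\<Prod>T) = T" if "T \<in> ?S" for T
    using that finQ prQ by (intro prime_factors_prod_primes) (auto intro: finite_subset)
  have "\<exists>q. prime q \<and> ord q (2::nat) = \<Prod>T" if T: "T \<in> ?S" for T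
  proof (rule exists_primitive_prime)
    have prT: "prime p" "odd p" if "p \<in> T" for p
      using that T prQ Q(2) primes_dvd_imp_eq[OF two_is_prime_nat, of p] by auto
    have finT: "finite T" using T finQ by (auto intro: finite_subset)
    show "odd (\<Prod>T)" using prT finT by (simp add: even_prod_iff)
    obtain p where p: "p \<in> T" using T by auto
    have "\<Prod>T > 0" using prT by (intro prod_pos) (simp add: prime_gt_0_nat)
    moreover have "p dvd \<Prod>T" using dvd_prodI[OF finT p, of "\<lambda>x. x"] by simp
    ultimately have "p \<le> \<Prod>T" by (intro dvd_imp_le)
    thus "\<Prod>T > 1" using prime_gt_1_nat[OF prT(1)[OF p]] by (rule less_le_trans[rotated])
    have "(\<Sum>r\<in>T. 1 / real r) \<le> (\<Sum>r\<in>Q. 1 / real r)"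
      using T finQ by (intro sum_mono2) auto
    thus "(\<Sum>r\<in>prime_factors (\<Prod>T). 1 / real r) \<le> 1 / 2"
      using small pf[OF T] by simp
  qed
  then obtain g where g: "\<And>T. T \<in> ?S \<Longrightarrow> prime (g T) \<and> ord (g T) (2::nat) = \<Prod>T"
    by metis
  \<comment> \<open>Equal primes have equal orders, hence equal products, whose prime factors
    recover the subset.\<close>
  have inj: "inj_on g ?S"
    by (rule inj_onI) (metis g pf)
  have sub: "g ` ?S \<subseteq> prime_factors (mersenne n)"
  proof
    fix q assume "q \<in> g ` ?S"
    then obtain T where T: "T \<in> ?S" "q = g T" by blast
    have "T \<subseteq> prime_factors n" using T Q by auto
    hence "\<Prod>T dvd \<Prod>(prime_factors n)"
      by (intro prod_dvd_prod_subset) auto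
    also have "\<Prod>(prime_factors n) dvd (\<Prod>p\<in>prime_factors n. p ^ multiplicity p n)"
      by (intro prod_dvd_prod) (auto simp: prime_factors_multiplicity intro!: dvd_power)
    also have "\<dots> = n" using n prime_factorization_nat[of n] by simp
    finally show "q \<in> prime_factors (mersenne n)"
      using g[OF T(1)] T(2) mersenne_pos[OF n]
      by (auto simp: prime_factors_dvd prime_dvd_mersenne_iff)
  qed
  have "card ?S = 2 ^ card Q - 1" using finQ by (simp add: card_Diff_singleton card_Pow)
  moreover have "card ?S \<le> card (prime_factors (mersenne n))"
    using card_image[OF inj] card_mono[OF _ sub] by simp
  ultimately show ?thesis by (simp add: omega_def)
qed

section \<open>Density of the exceptional set\<close>

lemma ln_ln_at_top: "filterlim (\<lambda>N. ln (ln (real N))) at_top sequentially"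
  by (intro filterlim_compose[OF ln_at_top] filterlim_real_sequentially)

text \<open>The loss \<open>K + 1\<close> between ln ln N and \<open>S\<close> is at most half of
  \<open>e * S\<close>, so (1 - e) ln ln n stays below \<open>S - e * S / 2\<close>, the threshold
  for the number of prime divisors. Replacing \<epsilon> by \<open>e\<close> requires ln ln n to be
  nonnegative, which is why 1 and 2 are set aside.\<close>

lemma exceptional_set_subset:
  fixes \<epsilon> e :: real and K N :: nat
  assumes K: "K \<ge> 2" and N: "N \<ge> 2" and e: "0 < e" "e \<le> 1" "e \<le> \<epsilon>"
  defines "P \<equiv> {p. prime p \<and> K < p \<and> p \<le> N}"
  defines "S \<equiv> \<Sum>p\<in>P. 1 / real p"
  assumes S: "e * S \<ge> 2 * (real K + 1)"
  shows "{n. 0 < n \<and> \<not> real (omega (mersenne n)) > 2 powr ((1 - \<epsilon>) * ln (ln (real n))) - 3} \<inter> {1..N}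
    \<subseteq> {1, 2} \<union> {n\<in>{1..N}. (\<Sum>p | p \<in> P \<and> p dvd n. 1 / real p) \<ge> 1 / 2}
        \<union> {n\<in>{1..N}. real (card {p\<in>P. p dvd n}) \<le> S - e * S / 2}"
proof -
  have "real (omega (mersenne n)) > 2 powr ((1 - \<epsilon>) * ln (ln (real n))) - 3"
    if range: "n \<in> {1..N}" "n \<notin> {1, 2}"
      and few: "(\<Sum>p | p \<in> P \<and> p dvd n. 1 / real p) < 1 / 2"
      and many: "real (card {p\<in>P. p dvd n}) > S - e * S / 2" for n
  proof -
    have n: "3 \<le> n" "n \<le> N" using range by auto
    define w where "w = card {p\<in>P. p dvd n}"
    have "ln (real n) \<ge> 1"
      using n exp_le by (subst ln_ge_iff) linarith+
    hence lnln: "0 \<le> ln (ln (real n))" by simp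
    have "ln (ln (real n)) \<le> ln (ln (real N))"
      using n \<open>ln (real n) \<ge> 1\<close> by simp
    also have "\<dots> \<le> S + (real K + 1)"
      using sum_primes_between_ge[OF N, of K] by (simp add: S_def P_def)
    finally have le: "ln (ln (real n)) \<le> S + (real K + 1)" .
    have "(1 - \<epsilon>) * ln (ln (real n)) \<le> (1 - e) * ln (ln (real n))"
      using e lnln by (intro mult_right_mono) auto
    also have "\<dots> \<le> (1 - e) * (S + (real K + 1))"
      using e le by (intro mult_left_mono) auto
    also have "\<dots> \<le> S - e * S + (real K + 1)"
      using e by (simp add: algebra_simps)
    also have "\<dots> \<le> S - e * S / 2" using S by (simp add: field_simps)
    also have "\<dots> \<le> real w" using many by (simp add: w_def)
    finally have "2 powr ((1 - \<epsilon>) * ln (ln (real n))) \<le> 2 powr real w" by simp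
    also have "\<dots> = real (2 ^ w)" by (simp add: powr_realpow)
    finally have "2 powr ((1 - \<epsilon>) * ln (ln (real n))) \<le> real (2 ^ w)" .
    \<comment> \<open>As K >= 2, all primes in \<open>P\<close> are odd.\<close>
    moreover have "2 ^ w - 1 \<le> omega (mersenne n)"
      unfolding w_def using n K few
      by (intro omega_mersenne_ge) (auto simp: P_def prime_factors_dvd)
    hence "real (2 ^ w) \<le> real (omega (mersenne n)) + 1" by linarith
    ultimately show ?thesis by linarith
  qed
  thus ?thesis unfolding not_le[symmetric] by blast
qed

theorem theorem4:
  fixes \<epsilon> :: real
  assumes "\<epsilon> > 0"
  shows "almost_all (\<lambda>n. real (omega (mersenne n)) > 2 powr ((1 - \<epsilon>) * ln (ln (real n))) - 3)"
proof -
  let ?bad = "{n. 0 < n \<and> \<not> real (omega (mersenne n)) > 2 powr ((1 - \<epsilon>) * ln (ln (real n))) - 3}"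
  \<comment> \<open>Capping at 1 keeps \<open>1 - e\<close> nonnegative.\<close>
  define e where "e = min \<epsilon> 1"
  have e: "0 < e" "e \<le> 1" "e \<le> \<epsilon>" using assms by (auto simp: e_def)
  have "eventually (\<lambda>N. real (card (?bad \<inter> {1..N})) / real N < \<delta>) sequentially"
    if \<delta>: "\<delta> > 0" for \<delta> :: real
  proof -
    \<comment> \<open>Chosen so that the reciprocal condition fails on a proportion 2/K below
      \<delta>/3.\<close>
    define K where "K = nat \<lceil>6 / \<delta>\<rceil> + 2"
    have K: "K \<ge> 2" and "real K > 6 / \<delta>" by (simp add: K_def, unfold K_def, linarith)
    hence K\<delta>: "2 / real K < \<delta> / 3" using \<delta> by (simp add: field_simps)
    \<comment> \<open>The first entry of the maximum makes \<open>K + 1\<close> at most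
      \<open>e * S / 2\<close>, and the second makes the variance term 12/(e^2 S) less than
      \<delta>/3. The final summand pays for passing from ln ln N to \<open>S\<close>.\<close>
    let ?t = "max (2 * (real K + 1) / e) (36 / (e\<^sup>2 * \<delta>) + 1) + (real K + 1)"
    have "eventually (\<lambda>N. ln (ln (real N)) \<ge> ?t) sequentially"
      using ln_ln_at_top by (simp add: filterlim_at_top)
    moreover have "eventually (\<lambda>N. real N > 6 / \<delta>) sequentially"
      using filterlim_real_sequentially by (simp add: filterlim_at_top_dense)
    ultimately show ?thesis using eventually_ge_at_top[of 2]
    proof eventually_elim
      case (elim N)
      define P where "P = {p. prime p \<and> K < p \<and> p \<le> N}"
      define S where "S = (\<Sum>p\<in>P. 1 / real p)"
      define t where "t = e * S / 2"
      have "S \<ge> ln (ln (real N)) - (real K + 1)"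
        unfolding S_def P_def using elim by (intro sum_primes_between_ge) auto
      hence "S \<ge> max (2 * (real K + 1) / e) (36 / (e\<^sup>2 * \<delta>) + 1)" using elim(1) by linarith
      hence S1: "S \<ge> 2 * (real K + 1) / e" and S2: "S > 36 / (e\<^sup>2 * \<delta>)" by auto
      have "36 / (e\<^sup>2 * \<delta>) > 0" using e \<delta> by simp
      hence Spos: "S > 0" using S2 by linarith
      have S1': "e * S \<ge> 2 * (real K + 1)" using S1 e by (simp add: field_simps)
      have tpos: "t > 0" using e Spos by (simp add: t_def)
      have Psub: "P \<subseteq> {K<..N}" by (auto simp: P_def)
      have finP: "finite P" using Psub finite_subset by blast
      have cardP: "card P \<le> N" using card_mono[OF _ Psub] by simp
      let ?B1 = "{n\<in>{1..N}. (\<Sum>p | p \<in> P \<and> p dvd n. 1 / real p) \<ge> 1 / 2}"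
      let ?B2 = "{n\<in>{1..N}. real (card {p\<in>P. p dvd n}) \<le> S - t}"
      have "?bad \<inter> {1..N} \<subseteq> {1, 2} \<union> ?B1 \<union> ?B2"
        using exceptional_set_subset[OF K elim(3) e] S1' unfolding t_def S_def P_def by blast
      hence "card (?bad \<inter> {1..N}) \<le> card ({1, 2} \<union> ?B1 \<union> ?B2)" by (intro card_mono) auto
      also have "\<dots> \<le> card ({1, 2} \<union> ?B1) + card ?B2" by (rule card_Un_le)
      also have "card ({1, 2} \<union> ?B1) \<le> card {1, 2 :: nat} + card ?B1" by (rule card_Un_le)
      finally have "real (card (?bad \<inter> {1..N})) \<le> 2 + real (card ?B1) + real (card ?B2)" by simp
      also have "real (card ?B1) \<le> 2 * real N / real K"
        using K Psub by (intro card_large_reciprocal_sum_le) auto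
      also have "real (card ?B2) \<le> S * (real N + 2 * real (card P)) / t\<^sup>2"
        unfolding S_def using finP tpos by (intro card_few_prime_divisors_le) (auto simp: P_def)
      \<comment> \<open>The trivial bound of N for the number of primes suffices here.\<close>
      also have "\<dots> \<le> S * (3 * real N) / t\<^sup>2"
        using cardP Spos by (intro divide_right_mono mult_left_mono) auto
      also have "\<dots> = 12 * real N / (e\<^sup>2 * S)"
        using Spos e by (simp add: t_def power2_eq_square field_simps)
      finally have "real (card (?bad \<inter> {1..N})) / real N
          \<le> (2 + 2 * real N / real K + 12 * real N / (e\<^sup>2 * S)) / real N"
        by (intro divide_right_mono) auto
      also have "\<dots> = 2 / real N + 2 / real K + 12 / (e\<^sup>2 * S)"
        using elim(3) by (simp add: add_divide_distrib)
      also have "2 / real N < \<delta> / 3" using elim(2,3) \<delta> by (simp add: field_simps)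
      also have "12 / (e\<^sup>2 * S) < \<delta> / 3" using S2 Spos e \<delta> by (simp add: field_simps)
      finally show ?case using K\<delta> by linarith
    qed
  qed
  hence "(\<lambda>N. real (card (?bad \<inter> {1..N})) / real N) \<longlonglongrightarrow> 0"
    by (intro tendstoI) simp
  thus ?thesis by (simp only: almost_all_def has_natural_density_def)
qed

end
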